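(* Let $f$ be a sufficiently smooth real-valued function and let $u$ be the exact solution of $u'=f(t,u)$ near a fixed time $t$. For coefficients $a_{21},b_1,b_2,c_2\in\mathbb R$ and a real number $\epsilon^2$ (not depending on $h$), let $\tau(h)$ be the local truncation error at $t$ of the two-stage RBF Runge-Kutta method (defined in the context). (i) If $b_1+b_2=1$, $a_{21}=c_2$ and $b_2c_2=\frac12$, then $\tau(h)=O(h^2)$ as $h\to0$ (the method has order at least $2$). (ii) If moreover $b_2c_2^2=\frac13$, i.e. $a_{21}=c_2=\frac23$, $b_1=\frac14$, $b_2=\frac34$, and $u(t)\neq0$, and the shape parameter is chosen as $$\epsilon^2=-\frac{f_t+f_uf}{2u(t)}=-\frac{u''(t)}{2u(t)},$$ where $f,f_t,f_u$ are evaluated at $(t,u(t))$, then $\tau(h)=O(h^3)$ as $h\to0$ (the method is third-order accurate).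
   Context: The two-stage RBF Runge-Kutta method with step $h$ and squared shape parameter $\epsilon^2\in\mathbb R$ (the shape parameter $\epsilon$ is real or purely imaginary, so $\epsilon^2$ is real of either sign) maps the value $v$ at time $t$ to $v+h(b_1k_1+b_2k_2)$, where $$k_1=f(t,v),\qquad k_2=f\big(t+c_2h,\;v\,e^{-\epsilon^2(a_{21}h)^2}+h\,a_{21}k_1\big).$$ Its local truncation error at $t$ is the error of a single step started from the exact value, divided by $h$: $$\tau(h)=\frac{u(t+h)-u(t)}{h}-(b_1k_1+b_2k_2)\quad\text{with } v=u(t).$$ The method is said to have order $p$ when $\tau(h)=O(h^p)$. Subscripts $t,u$ on $f$ denote partial derivatives. *)

theory Defs
  imports "HOL-Analysis.Analysis" "HOL-Library.Landau_Symbols"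
begin

definition partial_t :: "(real \<Rightarrow> real \<Rightarrow> real) \<Rightarrow> real \<Rightarrow> real \<Rightarrow> real" where
  "partial_t f x y = deriv (\<lambda>s. f s y) x"

definition partial_u :: "(real \<Rightarrow> real \<Rightarrow> real) \<Rightarrow> real \<Rightarrow> real \<Rightarrow> real" where
  "partial_u f x y = deriv (\<lambda>v. f x v) y"

text \<open>Class \<open>C\<^sup>k\<close> in the classical sense, intended for open sets \<open>D\<close>: all partial derivatives
  of order at most \<open>k\<close> exist and are continuous on \<open>D\<close>. Since \<open>D\<close> is open, every point of \<open>D\<close>
  has horizontal and vertical segments around it inside \<open>D\<close>, so values of \<open>f\<close> outside \<open>D\<close> do
  not matter.\<close>

primrec Ck_on :: "nat \<Rightarrow> (real \<times> real) set \<Rightarrow> (real \<Rightarrow> real \<Rightarrow> real) \<Rightarrow> bool" where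
  "Ck_on 0 D f \<longleftrightarrow> continuous_on D (\<lambda>(x, y). f x y)"
| "Ck_on (Suc k) D f \<longleftrightarrow>
     continuous_on D (\<lambda>(x, y). f x y) \<and>
     (\<forall>(x, y) \<in> D. (\<lambda>s. f s y) field_differentiable (at x) \<and>
                   (\<lambda>v. f x v) field_differentiable (at y)) \<and>
     Ck_on k D (partial_t f) \<and> Ck_on k D (partial_u f)"

definition rbf_k1 :: "(real \<Rightarrow> real \<Rightarrow> real) \<Rightarrow> real \<Rightarrow> real \<Rightarrow> real" where
  "rbf_k1 f t v = f t v"

text \<open>The parameter \<open>eps2\<close> is the squared shape parameter itself, hence a real number of
  either sign.\<close>

definition rbf_k2 ::
  "(real \<Rightarrow> real \<Rightarrow> real) \<Rightarrow> real \<Rightarrow> real \<Rightarrow> real \<Rightarrow> real \<Rightarrow> real \<Rightarrow> real \<Rightarrow> real" where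
  "rbf_k2 f a21 c2 eps2 h t v =
     f (t + c2 * h) (v * exp (- eps2 * (a21 * h)\<^sup>2) + h * a21 * rbf_k1 f t v)"

definition rbf_step ::
  "(real \<Rightarrow> real \<Rightarrow> real) \<Rightarrow> real \<Rightarrow> real \<Rightarrow> real \<Rightarrow> real \<Rightarrow> real \<Rightarrow> real \<Rightarrow> real \<Rightarrow> real \<Rightarrow> real" where
  "rbf_step f a21 b1 b2 c2 eps2 h t v =
     v + h * (b1 * rbf_k1 f t v + b2 * rbf_k2 f a21 c2 eps2 h t v)"

definition rbf_local_error ::
  "(real \<Rightarrow> real \<Rightarrow> real) \<Rightarrow> (real \<Rightarrow> real) \<Rightarrow> real \<Rightarrow> real \<Rightarrow> real \<Rightarrow> real \<Rightarrow> real \<Rightarrow> real \<Rightarrow> real \<Rightarrow> real" where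
  "rbf_local_error f u a21 b1 b2 c2 eps2 t h =
     (u (t + h) - u t) / h
       - (b1 * rbf_k1 f t (u t) + b2 * rbf_k2 f a21 c2 eps2 h t (u t))"

lemma rbf_local_error_eq_step:
  assumes "h \<noteq> 0"
  shows "rbf_local_error f u a21 b1 b2 c2 eps2 t h =
    (u (t + h) - rbf_step f a21 b1 b2 c2 eps2 h t (u t)) / h"
  using assms by (simp add: rbf_local_error_def rbf_step_def field_simps)

end

theory Submission
  imports Defs
begin

text \<open>Along the exact solution the increment quotient \<open>(u (t + h) - u t) / h\<close> and the second stage
\<open>G h = k\<^sub>2\<close> are both \<open>f\<close> evaluated along a curve \<open>s \<mapsto> (\<alpha> s, \<beta> s)\<close>, the former up to one
integration: \<open>u' s = f s (u s)\<close> and \<open>G h = f (t + c\<^sub>2 h) (\<psi> h)\<close>, where \<open>\<psi>\<close> is the stage value. So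
everything reduces to one-variable Taylor expansion, and the order conditions say that the
coefficients of \<open>(u (t + h) - u t) / h\<close> and of \<open>b\<^sub>1 k\<^sub>1 + b\<^sub>2 G\<close> agree below \<open>h ^ k\<close>
(lemma \<open>rbf_local_error_bigo\<close>).

The second derivative of \<open>f\<close> along a curve is a quadratic form in the velocity, plus the gradient
of \<open>f\<close> paired with the acceleration (\<open>second_deriv_compose\<close>). The velocity of the stage curve at
\<open>0\<close> is \<open>c\<^sub>2\<close> times that of the solution curve. With \<open>A\<close> denoting the quadratic form at the
velocity \<open>(1, f)\<close>, this gives \<open>u''' = A + f\<^sub>u u''\<close> and \<open>G'' = c\<^sub>2\<^sup>2 (A + f\<^sub>u (- 2 \<epsilon>\<^sup>2 u))\<close>
(\<open>ode_solution_derivs\<close>, \<open>rbf_k2_derivs\<close>). At \<open>h = 0\<close> the shape parameter affects only the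
acceleration of the stage curve, and the choice \<open>- 2 \<epsilon>\<^sup>2 u = u''\<close> makes it equal, up to the factor
\<open>c\<^sub>2\<^sup>2\<close>, to the acceleration of the solution curve. Then \<open>G'' = c\<^sub>2\<^sup>2 u'''\<close>, and
\<open>b\<^sub>2 c\<^sub>2\<^sup>2 = 1/3\<close> makes the terms in \<open>h\<^sup>2\<close> cancel. The terms of order \<open>0\<close> and \<open>1\<close> do not see
\<open>\<epsilon>\<close> and cancel by \<open>b\<^sub>1 + b\<^sub>2 = 1\<close> and \<open>b\<^sub>2 c\<^sub>2 = 1/2\<close>.

The remainders have the right size because a solution of the equation is once more
differentiable than \<open>f\<close> (\<open>smooth_near_ode_solution\<close>); this extra derivative pays for the division
by \<open>h\<close>.\<close>

section \<open>Functions of class C^k near a point\<close>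

text \<open>The derivatives of order below \<open>k\<close> are differentiable near \<open>x\<close>, and the \<open>k\<close>-th one is continuous
at \<open>x\<close> itself. This bounds the \<open>k\<close>-th derivative near \<open>x\<close>, which is what a Lagrange remainder
needs; asking for continuity only at the point \<open>x\<close> saves bookkeeping of neighbourhoods.\<close>

primrec smooth_near :: "nat \<Rightarrow> real \<Rightarrow> (real \<Rightarrow> real) \<Rightarrow> bool" where
  "smooth_near 0 x g \<longleftrightarrow> isCont g x"
| "smooth_near (Suc k) x g \<longleftrightarrow>
     (\<forall>\<^sub>F s in nhds x. g field_differentiable (at s)) \<and> smooth_near k x (deriv g)"

lemma smooth_near_cong:
  assumes "\<forall>\<^sub>F s in nhds x. g s = h s"
  shows "smooth_near k x g \<longleftrightarrow> smooth_near k x h"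
  using assms
proof (induction k arbitrary: g h)
  case 0
  then show ?case by (simp add: isCont_cong)
next
  case (Suc k)
  have ev: "\<forall>\<^sub>F s in nhds x. \<forall>\<^sub>F r in nhds s. g r = h r"
    using Suc.prems by (simp add: eventually_eventually)
  have "\<forall>\<^sub>F s in nhds x. deriv g s = deriv h s"
    using ev by (rule eventually_mono) (rule deriv_cong_ev, auto)
  moreover have "\<forall>\<^sub>F s in nhds x. g field_differentiable (at s) \<longleftrightarrow> h field_differentiable (at s)"
    using ev by (rule eventually_mono)
      (auto simp: field_differentiable_def DERIV_cong_ev)
  ultimately show ?case
    using Suc.IH[of "deriv g" "deriv h"] by (auto elim: eventually_elim2)
qed

lemma smooth_near_SucI:
  assumes "\<forall>\<^sub>F s in nhds x. (g has_real_derivative g' s) (at s)"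
    and "smooth_near k x g'"
  shows "smooth_near (Suc k) x g"
proof -
  have "\<forall>\<^sub>F s in nhds x. deriv g s = g' s"
    using assms(1) by (rule eventually_mono) (rule DERIV_imp_deriv)
  moreover have "\<forall>\<^sub>F s in nhds x. g field_differentiable (at s)"
    using assms(1) by (rule eventually_mono) (auto simp: field_differentiable_def)
  ultimately show ?thesis
    using assms(2) smooth_near_cong by auto
qed

lemma smooth_near_SucD:
  "smooth_near (Suc k) x g \<Longrightarrow>
    \<forall>\<^sub>F s in nhds x. (g has_real_derivative deriv g s) (at s)"
  by (auto elim!: eventually_mono simp: DERIV_deriv_iff_field_differentiable)

lemma smooth_near_weaken: "smooth_near (Suc k) x g \<Longrightarrow> smooth_near k x g"
proof (induction k arbitrary: g)
  case 0
  then show ?case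
    by (auto dest: eventually_nhds_x_imp_x field_differentiable_imp_continuous_at)
next
  case (Suc k)
  then show ?case by (metis smooth_near.simps(2))
qed

lemma smooth_near_imp_isCont: "smooth_near k x g \<Longrightarrow> isCont g x"
  by (induction k) (auto dest: eventually_nhds_x_imp_x field_differentiable_imp_continuous_at)

lemma smooth_near_const: "smooth_near k x (\<lambda>s. c)"
  by (induction k arbitrary: c) auto

lemma smooth_near_ident: "smooth_near k x (\<lambda>s. s)"
proof (cases k)
  case (Suc j)
  show ?thesis
    unfolding Suc by (rule smooth_near_SucI[where g' = "\<lambda>s. 1"]) (auto simp: smooth_near_const)
qed simp

lemma smooth_near_add:
  "smooth_near k x g \<Longrightarrow> smooth_near k x h \<Longrightarrow> smooth_near k x (\<lambda>s. g s + h s)"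
proof (induction k arbitrary: g h)
  case (Suc k)
  have "\<forall>\<^sub>F s in nhds x. ((\<lambda>s. g s + h s) has_real_derivative deriv g s + deriv h s) (at s)"
    using smooth_near_SucD[OF Suc.prems(1)] smooth_near_SucD[OF Suc.prems(2)]
    by eventually_elim (rule DERIV_add)
  then show ?case
    using Suc by (intro smooth_near_SucI) auto
qed (auto intro: continuous_intros)

lemma smooth_near_mult:
  "smooth_near k x g \<Longrightarrow> smooth_near k x h \<Longrightarrow> smooth_near k x (\<lambda>s. g s * h s)"
proof (induction k arbitrary: g h)
  case (Suc k)
  have "\<forall>\<^sub>F s in nhds x. ((\<lambda>s. g s * h s) has_real_derivative
          deriv g s * h s + deriv h s * g s) (at s)"
    using smooth_near_SucD[OF Suc.prems(1)] smooth_near_SucD[OF Suc.prems(2)]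
    by eventually_elim (rule DERIV_mult)
  moreover have "smooth_near k x (\<lambda>s. deriv g s * h s + deriv h s * g s)"
    using Suc.prems Suc.prems[THEN smooth_near_weaken]
    by (intro smooth_near_add Suc.IH) auto
  ultimately show ?case
    by (rule smooth_near_SucI)
qed (auto intro: continuous_intros)

lemma smooth_near_exp:
  "smooth_near k x g \<Longrightarrow> smooth_near k x (\<lambda>s. exp (g s))"
proof (induction k arbitrary: g)
  case (Suc k)
  have "\<forall>\<^sub>F s in nhds x. ((\<lambda>s. exp (g s)) has_real_derivative exp (g s) * deriv g s) (at s)"
    using smooth_near_SucD[OF Suc.prems] by eventually_elim (rule DERIV_fun_exp)
  moreover have "smooth_near k x (\<lambda>s. exp (g s) * deriv g s)"
    using Suc.prems Suc.prems[THEN smooth_near_weaken]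
    by (intro smooth_near_mult Suc.IH) auto
  ultimately show ?case
    by (rule smooth_near_SucI)
qed (auto intro: continuous_intros)

lemma smooth_near_higher_deriv:
  assumes "smooth_near n x g"
  shows "m < n \<Longrightarrow> \<forall>\<^sub>F s in nhds x.
           ((deriv ^^ m) g has_real_derivative (deriv ^^ Suc m) g s) (at s)"
    and "isCont ((deriv ^^ n) g) x"
  using assms
proof (induction n arbitrary: g m)
  case (Suc n)
  {
    case 1
    then show ?case
      using Suc.IH(1)[of "m - 1" "deriv g"] smooth_near_SucD[of n x g]
      by (cases m) (auto simp: funpow_swap1)
  next
    case 2
    then show ?case
      using Suc.IH(2)[of "deriv g"] by (simp add: funpow_swap1)
  }
qed auto

text \<open>The Lagrange form of the remainder involves the \<open>n\<close>-th derivative at a point between \<open>x\<close> and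
\<open>x + h\<close>, and continuity of that derivative at \<open>x\<close> bounds it uniformly in small \<open>h\<close>.\<close>

lemma smooth_near_taylor:
  assumes "smooth_near n x g"
  shows "(\<lambda>h. g (x + h) - (\<Sum>m<n. (deriv ^^ m) g x / fact m * h ^ m)) \<in> O[at 0](\<lambda>h. h ^ n)"
proof -
  have "\<forall>\<^sub>F s in nhds x. \<forall>m\<in>{..<n}.
          ((deriv ^^ m) g has_real_derivative (deriv ^^ Suc m) g s) (at s)"
    using smooth_near_higher_deriv(1)[OF assms] by (intro eventually_ball_finite) auto
  moreover have "\<forall>\<^sub>F s in nhds x. \<bar>(deriv ^^ n) g s\<bar> < \<bar>(deriv ^^ n) g x\<bar> + 1"
    using smooth_near_higher_deriv(2)[OF assms]
    by (intro order_tendstoD) (auto simp: isCont_def tendsto_at_iff_tendsto_nhds intro!: tendsto_intros)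
  ultimately have "\<forall>\<^sub>F s in nhds x. (\<forall>m<n.
          ((deriv ^^ m) g has_real_derivative (deriv ^^ Suc m) g s) (at s)) \<and>
          \<bar>(deriv ^^ n) g s\<bar> < \<bar>(deriv ^^ n) g x\<bar> + 1"
    by eventually_elim auto
  then obtain d where "d > 0" and d: "\<And>s. dist s x < d \<Longrightarrow> (\<forall>m<n.
          ((deriv ^^ m) g has_real_derivative (deriv ^^ Suc m) g s) (at s)) \<and>
          \<bar>(deriv ^^ n) g s\<bar> < \<bar>(deriv ^^ n) g x\<bar> + 1"
    unfolding eventually_nhds_metric by blast
  have "norm (g (x + h) - (\<Sum>m<n. (deriv ^^ m) g x / fact m * h ^ m))
          \<le> (\<bar>(deriv ^^ n) g x\<bar> + 1) / fact n * norm (h ^ n)" if "dist h 0 < d" for h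
  proof -
    have "\<exists>s. \<bar>s\<bar> \<le> \<bar>h\<bar> \<and> g (x + h) =
        (\<Sum>m<n. (deriv ^^ m) g (x + 0) / fact m * h ^ m) + (deriv ^^ n) g (x + s) / fact n * h ^ n"
    proof (rule Maclaurin_bi_le[where diff = "\<lambda>m s. (deriv ^^ m) g (x + s)"])
      show "\<forall>m s. m < n \<and> \<bar>s\<bar> \<le> \<bar>h\<bar> \<longrightarrow> ((\<lambda>s. (deriv ^^ m) g (x + s))
              has_real_derivative (deriv ^^ Suc m) g (x + s)) (at s)"
      proof (intro allI impI, elim conjE)
        fix m s assume "m < n" "\<bar>s\<bar> \<le> \<bar>h\<bar>"
        then have "((deriv ^^ m) g has_real_derivative (deriv ^^ Suc m) g (x + s)) (at (x + s))"
          using d[of "x + s"] that by (simp add: dist_norm)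
        then show "((\<lambda>s. (deriv ^^ m) g (x + s))
              has_real_derivative (deriv ^^ Suc m) g (x + s)) (at s)"
          by (simp add: DERIV_shift add.commute)
      qed
    qed simp
    then obtain s where s: "\<bar>s\<bar> \<le> \<bar>h\<bar>" "g (x + h) -
        (\<Sum>m<n. (deriv ^^ m) g x / fact m * h ^ m) = (deriv ^^ n) g (x + s) / fact n * h ^ n"
      by auto
    have "\<bar>(deriv ^^ n) g (x + s)\<bar> \<le> \<bar>(deriv ^^ n) g x\<bar> + 1"
      using d[of "x + s"] s(1) that by (simp add: dist_norm)
    then show ?thesis
      unfolding s(2) by (auto simp: abs_mult intro!: mult_right_mono divide_right_mono)
  qed
  then show ?thesis
    using \<open>d > 0\<close>
    by (intro bigoI[where c = "(\<bar>(deriv ^^ n) g x\<bar> + 1) / fact n"])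
      (auto simp: eventually_at intro!: exI[of _ d])
qed

section \<open>Composition with a function of two variables\<close>

lemma Ck_on_weaken: "Ck_on (Suc k) D f \<Longrightarrow> Ck_on k D f"
proof (induction k arbitrary: f)
  case (Suc k)
  then show ?case
    using Ck_on.simps(2)[of "Suc k" D f] Ck_on.simps(2)[of k D f] by blast
qed simp

lemma Ck_on_le:
  assumes "Ck_on k D f" and "j \<le> k"
  shows "Ck_on j D f"
  using assms(2,1) by (induction rule: dec_induct) (auto dest: Ck_on_weaken simp del: Ck_on.simps)

text \<open>Continuity of the partial derivatives upgrades them to a total derivative of \<open>f\<close>. The criterion
\<open>has_derivative_partialsI\<close> asks for a product neighbourhood with convex second factor, hence the
ball inside a box inside \<open>D\<close>.\<close>

lemma chain_rule_partials:
  assumes "open D" and Ck: "Ck_on (Suc 0) D f" and "(\<alpha> x, \<beta> x) \<in> D"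
    and \<alpha>: "(\<alpha> has_real_derivative a) (at x)" and \<beta>: "(\<beta> has_real_derivative b) (at x)"
  shows "((\<lambda>s. f (\<alpha> s) (\<beta> s)) has_real_derivative
           partial_t f (\<alpha> x) (\<beta> x) * a + partial_u f (\<alpha> x) (\<beta> x) * b) (at x)"
proof -
  obtain A B where AB: "open A" "open B" "(\<alpha> x, \<beta> x) \<in> A \<times> B" "A \<times> B \<subseteq> D"
    using open_prod_elim[OF assms(1,3)] by blast
  obtain e where e: "e > 0" "ball (\<beta> x) e \<subseteq> B"
    using AB openE by (metis mem_Sigma_iff)
  define Y where "Y = ball (\<beta> x) e"
  have in_D: "(r, y) \<in> D" if "r \<in> A" "y \<in> Y" for r y
    using that AB(4) e(2) by (auto simp: Y_def)
  have "open Y" "convex Y" "\<beta> x \<in> Y"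
    using e(1) by (auto simp: Y_def)
  have "((\<lambda>(r, y). f r y) has_derivative (\<lambda>(p, q). partial_t f (\<alpha> x) (\<beta> x) * p +
      blinfun_apply (blinfun_scaleR_left (partial_u f (\<alpha> x) (\<beta> x))) q))
      (at (\<alpha> x, \<beta> x) within A \<times> Y)"
  proof (rule has_derivative_partialsI)
    have "(\<lambda>r. f r (\<beta> x)) field_differentiable (at (\<alpha> x))"
      using Ck assms(3) by auto
    then have "((\<lambda>r. f r (\<beta> x)) has_real_derivative partial_t f (\<alpha> x) (\<beta> x)) (at (\<alpha> x) within A)"
      unfolding partial_t_def
      by (simp add: DERIV_deriv_iff_field_differentiable has_field_derivative_at_within)
    then show "((\<lambda>r. f r (\<beta> x)) has_derivative (*) (partial_t f (\<alpha> x) (\<beta> x))) (at (\<alpha> x) within A)"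
      by (simp add: has_field_derivative_def)
  next
    fix r y assume "r \<in> A" "y \<in> Y"
    then have "(r, y) \<in> D"
      by (rule in_D)
    then have "f r field_differentiable (at y)"
      using Ck by auto
    then have "(f r has_real_derivative partial_u f r y) (at y within Y)"
      unfolding partial_u_def
      by (simp add: DERIV_deriv_iff_field_differentiable has_field_derivative_at_within)
    moreover have "blinfun_apply (blinfun_scaleR_left (partial_u f r y)) = (*) (partial_u f r y)"
      by (simp add: fun_eq_iff)
    ultimately show "(f r has_derivative blinfun_apply (blinfun_scaleR_left (partial_u f r y)))
        (at y within Y)"
      by (simp add: has_field_derivative_def)
  next
    have "continuous_on (A \<times> Y) (\<lambda>p. partial_u f (fst p) (snd p))"
      using Ck in_D by (auto simp: case_prod_unfold intro: continuous_on_subset)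
    then have "continuous_on (A \<times> Y) 
        (\<lambda>p. blinfun_scaleR_left (partial_u f (fst p) (snd p)) :: real \<Rightarrow>\<^sub>L real)"
      by (intro bounded_linear.continuous_on[OF bounded_linear_blinfun_scaleR_left])
    then show "continuous (at (\<alpha> x, \<beta> x) within A \<times> Y)
        (\<lambda>(r, y). blinfun_scaleR_left (partial_u f r y) :: real \<Rightarrow>\<^sub>L real)"
      using AB(3) \<open>\<beta> x \<in> Y\<close> by (auto simp: case_prod_unfold continuous_on_eq_continuous_within)
  qed fact+
  then have "((\<lambda>(r, y). f r y) has_derivative (\<lambda>(p, q). partial_t f (\<alpha> x) (\<beta> x) * p +
      partial_u f (\<alpha> x) (\<beta> x) * q)) (at (\<alpha> x, \<beta> x))"
    using AB \<open>open Y\<close> \<open>\<beta> x \<in> Y\<close>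
    by (subst (asm) at_within_open) (auto simp: open_Times mult.commute)
  moreover have "((\<lambda>s. (\<alpha> s, \<beta> s)) has_derivative (\<lambda>h. (a * h, b * h))) (at x)"
    using \<alpha> \<beta> by (auto simp: has_field_derivative_def intro: has_derivative_Pair)
  ultimately have "((\<lambda>s. (\<lambda>(r, y). f r y) (\<alpha> s, \<beta> s)) has_derivative
      (\<lambda>h. (\<lambda>(p, q). partial_t f (\<alpha> x) (\<beta> x) * p + partial_u f (\<alpha> x) (\<beta> x) * q) (a * h, b * h))) (at x)"
    by (rule has_derivative_compose[rotated])
  then have "((\<lambda>s. f (\<alpha> s) (\<beta> s)) has_derivative
      (\<lambda>h. partial_t f (\<alpha> x) (\<beta> x) * (a * h) + partial_u f (\<alpha> x) (\<beta> x) * (b * h))) (at x)"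
    by simp
  then show ?thesis
    by (rule has_derivative_imp_has_field_derivative) (simp add: algebra_simps)
qed

lemma eventually_path_in_open:
  assumes "open D" and "(\<alpha> x, \<beta> x) \<in> D" and "isCont \<alpha> x" and "isCont \<beta> x"
  shows "\<forall>\<^sub>F s in nhds x. (\<alpha> s, \<beta> s) \<in> D"
proof -
  have "isCont (\<lambda>s. (\<alpha> s, \<beta> s)) x"
    using assms(3,4) by (intro continuous_intros)
  then have "((\<lambda>s. (\<alpha> s, \<beta> s)) \<longlongrightarrow> (\<alpha> x, \<beta> x)) (nhds x)"
    using tendsto_at_iff_tendsto_nhds[of "\<lambda>s. (\<alpha> s, \<beta> s)" x] by (simp add: isCont_def)
  then show ?thesis
    using assms(1,2) by (rule topological_tendstoD)
qed

lemma eventually_deriv_compose: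
  assumes "open D" and "(\<alpha> x, \<beta> x) \<in> D" and "Ck_on (Suc 0) D f"
    and "smooth_near (Suc k) x \<alpha>" and "smooth_near (Suc k) x \<beta>"
  shows "\<forall>\<^sub>F s in nhds x. ((\<lambda>s. f (\<alpha> s) (\<beta> s)) has_real_derivative
           partial_t f (\<alpha> s) (\<beta> s) * deriv \<alpha> s + partial_u f (\<alpha> s) (\<beta> s) * deriv \<beta> s) (at s)"
  using eventually_path_in_open[OF assms(1,2) assms(4,5)[THEN smooth_near_imp_isCont]]
    assms(4,5)[THEN smooth_near_SucD]
  by eventually_elim (rule chain_rule_partials[of D f \<alpha> _ \<beta>, OF assms(1,3)])

text \<open>The induction is over all \<open>f\<close> at once, since the derivative of the composition contains the
compositions of both partial derivatives with the same curve.\<close>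

lemma smooth_near_compose:
  assumes "open D" and "(\<alpha> x, \<beta> x) \<in> D"
  shows "Ck_on k D f \<Longrightarrow> smooth_near k x \<alpha> \<Longrightarrow> smooth_near k x \<beta> \<Longrightarrow>
    smooth_near k x (\<lambda>s. f (\<alpha> s) (\<beta> s))"
proof (induction k arbitrary: f)
  case 0
  then have "isCont (\<lambda>p. f (fst p) (snd p)) (\<alpha> x, \<beta> x)"
    using assms by (simp add: case_prod_unfold continuous_on_eq_continuous_at)
  moreover have "isCont (\<lambda>s. (\<alpha> s, \<beta> s)) x"
    using 0 by (auto intro: continuous_intros)
  ultimately have "isCont (\<lambda>s. (\<lambda>p. f (fst p) (snd p)) (\<alpha> s, \<beta> s)) x"
    by (rule isCont_o2[rotated])
  then show ?case by simp
next
  case (Suc k)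
  have "Ck_on (Suc 0) D f"
    using Suc.prems(1) by (rule Ck_on_le) simp
  have "smooth_near k x (\<lambda>s. partial_t f (\<alpha> s) (\<beta> s))"
    and "smooth_near k x (\<lambda>s. partial_u f (\<alpha> s) (\<beta> s))"
    using Suc.prems Suc.prems(2,3)[THEN smooth_near_weaken] by (simp_all add: Suc.IH)
  then have "smooth_near k x (\<lambda>s.
      partial_t f (\<alpha> s) (\<beta> s) * deriv \<alpha> s + partial_u f (\<alpha> s) (\<beta> s) * deriv \<beta> s)"
    using Suc.prems by (intro smooth_near_add smooth_near_mult) simp_all
  with eventually_deriv_compose[OF assms \<open>Ck_on (Suc 0) D f\<close> Suc.prems(2,3)] show ?case
    by (rule smooth_near_SucI)
qed

text \<open>For \<open>f\<close> of class \<open>C\<^sup>2\<close>, this is the second derivative of \<open>s \<mapsto> f (x + s * a) (y + s * b)\<close> at \<open>0\<close>.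
The two mixed partial derivatives are kept apart: the third derivative of the solution and the
second derivative of the stage contain this same expression, so their symmetry never enters.\<close>

definition second_directional_deriv ::
  "(real \<Rightarrow> real \<Rightarrow> real) \<Rightarrow> real \<Rightarrow> real \<Rightarrow> real \<Rightarrow> real \<Rightarrow> real" where
  "second_directional_deriv f x y a b =
     (partial_t (partial_t f) x y * a + partial_u (partial_t f) x y * b) * a +
     (partial_t (partial_u f) x y * a + partial_u (partial_u f) x y * b) * b"

lemma second_directional_deriv_scale:
  "second_directional_deriv f x y (c * a) (c * b) = c\<^sup>2 * second_directional_deriv f x y a b"
  by (simp add: second_directional_deriv_def power2_eq_square algebra_simps)

lemma second_deriv_compose:
  assumes "open D" and "(\<alpha> x, \<beta> x) \<in> D" and Ck: "Ck_on 2 D f"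
    and \<alpha>: "smooth_near 2 x \<alpha>" and \<beta>: "smooth_near 2 x \<beta>"
  shows "deriv (deriv (\<lambda>s. f (\<alpha> s) (\<beta> s))) x =
    second_directional_deriv f (\<alpha> x) (\<beta> x) (deriv \<alpha> x) (deriv \<beta> x) +
    partial_t f (\<alpha> x) (\<beta> x) * deriv (deriv \<alpha>) x + partial_u f (\<alpha> x) (\<beta> x) * deriv (deriv \<beta>) x"
proof -
  have Ck1: "Ck_on (Suc 0) D f" "Ck_on (Suc 0) D (partial_t f)" "Ck_on (Suc 0) D (partial_u f)"
    using Ck Ck_on_le[OF Ck] by (simp_all add: numeral_2_eq_2)
  have D1: "(\<alpha> has_real_derivative deriv \<alpha> x) (at x)" "(\<beta> has_real_derivative deriv \<beta> x) (at x)"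
    and D2: "(deriv \<alpha> has_real_derivative deriv (deriv \<alpha>) x) (at x)"
      "(deriv \<beta> has_real_derivative deriv (deriv \<beta>) x) (at x)"
    using \<alpha> \<beta> unfolding numeral_2_eq_2
    by (auto dest!: eventually_nhds_x_imp_x simp: DERIV_deriv_iff_field_differentiable)
  have "\<forall>\<^sub>F s in nhds x. deriv (\<lambda>s. f (\<alpha> s) (\<beta> s)) s =
          partial_t f (\<alpha> s) (\<beta> s) * deriv \<alpha> s + partial_u f (\<alpha> s) (\<beta> s) * deriv \<beta> s"
    using eventually_deriv_compose[OF assms(1,2) Ck1(1)
        \<alpha>[unfolded numeral_2_eq_2] \<beta>[unfolded numeral_2_eq_2]]
    by (rule eventually_mono) (rule DERIV_imp_deriv)
  then have "deriv (deriv (\<lambda>s. f (\<alpha> s) (\<beta> s))) x = deriv (\<lambda>s.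
          partial_t f (\<alpha> s) (\<beta> s) * deriv \<alpha> s + partial_u f (\<alpha> s) (\<beta> s) * deriv \<beta> s) x"
    by (rule deriv_cong_ev) simp
  also have "\<dots> = second_directional_deriv f (\<alpha> x) (\<beta> x) (deriv \<alpha> x) (deriv \<beta> x) +
    partial_t f (\<alpha> x) (\<beta> x) * deriv (deriv \<alpha>) x + partial_u f (\<alpha> x) (\<beta> x) * deriv (deriv \<beta>) x"
    by (rule DERIV_imp_deriv)
      (rule derivative_eq_intros chain_rule_partials[OF assms(1) Ck1(2) assms(2) D1]
         chain_rule_partials[OF assms(1) Ck1(3) assms(2) D1] D2 refl
        | simp add: second_directional_deriv_def algebra_simps)+
  finally show ?thesis .
qed

section \<open>Derivatives of the exact solution\<close>

text \<open>Bootstrapping: if \<open>u\<close> is of class \<open>C^j\<close> with \<open>j \<le> k\<close>, then so is \<open>s \<mapsto> f s (u s)\<close>, which is the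
derivative of \<open>u\<close>.\<close>

lemma smooth_near_ode_solution:
  assumes "open D" and "(t, u t) \<in> D" and "Ck_on k D f"
    and ode: "\<forall>\<^sub>F s in nhds t. (u has_real_derivative f s (u s)) (at s)"
  shows "j \<le> Suc k \<Longrightarrow> smooth_near j t u"
proof (induction j)
  case 0
  show ?case
    using eventually_nhds_x_imp_x[OF ode] by (auto dest: DERIV_isCont)
next
  case (Suc j)
  from Suc have "smooth_near j t u" and "j \<le> k"
    by simp_all
  then have "smooth_near j t (\<lambda>s. f s (u s))"
    using smooth_near_compose[where \<alpha> = "\<lambda>s. s" and \<beta> = u and x = t]
      Ck_on_le[OF assms(3)] smooth_near_ident assms(1,2) by blast
  then show ?case
    by (rule smooth_near_SucI[OF ode])
qed

lemma ode_solution_derivs: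
  assumes "open D" and "(t, u t) \<in> D" and Ck: "Ck_on 2 D f"
    and ode: "\<forall>\<^sub>F s in nhds t. (u has_real_derivative f s (u s)) (at s)"
  shows "deriv u t = f t (u t)"
    and "deriv (deriv u) t = partial_t f t (u t) + partial_u f t (u t) * f t (u t)"
    and "deriv (deriv (deriv u)) t = second_directional_deriv f t (u t) 1 (f t (u t)) +
      partial_u f t (u t) * deriv (deriv u) t"
proof -
  have ev: "\<forall>\<^sub>F s in nhds t. deriv u s = f s (u s)"
    using ode by (rule eventually_mono) (rule DERIV_imp_deriv)
  then show u1: "deriv u t = f t (u t)"
    by (rule eventually_nhds_x_imp_x)
  have "deriv (deriv u) t = deriv (\<lambda>s. f s (u s)) t"
    using ev by (rule deriv_cong_ev) simp
  also have "\<dots> = partial_t f t (u t) + partial_u f t (u t) * f t (u t)"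
    using chain_rule_partials[OF assms(1) Ck_on_le[OF Ck] assms(2) DERIV_ident
        eventually_nhds_x_imp_x[OF ode]]
    by (intro DERIV_imp_deriv) simp
  finally show "deriv (deriv u) t = partial_t f t (u t) + partial_u f t (u t) * f t (u t)" .
  have "\<forall>\<^sub>F s in nhds t. \<forall>\<^sub>F r in nhds s. deriv u r = f r (u r)"
    using ev by (simp add: eventually_eventually)
  then have "\<forall>\<^sub>F s in nhds t. deriv (deriv u) s = deriv (\<lambda>s. f s (u s)) s"
    by (rule eventually_mono) (rule deriv_cong_ev, simp_all)
  then have "deriv (deriv (deriv u)) t = deriv (deriv (\<lambda>s. f s (u s))) t"
    by (rule deriv_cong_ev) simp
  also have "\<dots> = second_directional_deriv f t (u t) 1 (f t (u t)) +
      partial_u f t (u t) * deriv (deriv u) t"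
    using second_deriv_compose[OF assms(1) _ Ck smooth_near_ident, of t u] assms(2) u1
      smooth_near_ode_solution[OF assms, of 2] by simp
  finally show "deriv (deriv (deriv u)) t = second_directional_deriv f t (u t) 1 (f t (u t)) +
      partial_u f t (u t) * deriv (deriv u) t" .
qed

section \<open>Derivatives of the second stage\<close>

lemma smooth_near_rbf_stage:
  "smooth_near k 0 (\<lambda>h. v * exp (- eps2 * (a21 * h)\<^sup>2) + h * a21 * w)"
  unfolding power2_eq_square
  by (intro smooth_near_add smooth_near_mult smooth_near_exp smooth_near_const smooth_near_ident)

text \<open>The shape parameter changes the acceleration of the stage value at \<open>0\<close> but not its velocity,
because it enters the exponent with \<open>h\<^sup>2\<close>.\<close>

lemma rbf_stage_derivs:
  fixes v w eps2 a21 :: real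
  defines "\<psi> \<equiv> \<lambda>h. v * exp (- eps2 * (a21 * h)\<^sup>2) + h * a21 * w"
  shows "deriv \<psi> 0 = a21 * w" and "deriv (deriv \<psi>) 0 = - 2 * eps2 * a21\<^sup>2 * v"
proof -
  have \<psi>': "deriv \<psi> = (\<lambda>h. - 2 * eps2 * a21\<^sup>2 * v * (h * exp (- eps2 * (a21 * h)\<^sup>2)) + a21 * w)"
    unfolding \<psi>_def
    by (intro ext DERIV_imp_deriv)
      (auto intro!: derivative_eq_intros simp: power2_eq_square algebra_simps)
  then show "deriv \<psi> 0 = a21 * w"
    by simp
  show "deriv (deriv \<psi>) 0 = - 2 * eps2 * a21\<^sup>2 * v"
    unfolding \<psi>' by (rule DERIV_imp_deriv) (auto intro!: derivative_eq_intros)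
qed

lemma smooth_near_rbf_k2:
  assumes "open D" and "(t, v) \<in> D" and "Ck_on k D f"
  shows "smooth_near k 0 (\<lambda>h. rbf_k2 f a21 c2 eps2 h t v)"
proof -
  have "smooth_near k 0 (\<lambda>h. t + c2 * h)"
    by (intro smooth_near_add smooth_near_mult smooth_near_const smooth_near_ident)
  then show ?thesis
    unfolding rbf_k2_def
    using smooth_near_compose[of D "\<lambda>h. t + c2 * h" 0
        "\<lambda>h. v * exp (- eps2 * (a21 * h)\<^sup>2) + h * a21 * rbf_k1 f t v" k f]
      smooth_near_rbf_stage assms by simp
qed

text \<open>With \<open>a\<^sub>2\<^sub>1 = c\<^sub>2 = c\<close> the stage curve has at \<open>0\<close> the velocity \<open>c\<close> times \<open>(1, f)\<close>, and \<open>(1, f)\<close> is the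
velocity of the solution curve; this makes the derivatives comparable to those of the exact
solution.\<close>

lemma rbf_k2_derivs:
  fixes c eps2 :: real
  assumes "open D" and "(t, v) \<in> D" and Ck: "Ck_on 2 D f"
  defines "G \<equiv> \<lambda>h. rbf_k2 f c c eps2 h t v"
  shows "deriv G 0 = c * (partial_t f t v + partial_u f t v * f t v)"
    and "deriv (deriv G) 0 = c\<^sup>2 * (second_directional_deriv f t v 1 (f t v) -
           2 * eps2 * v * partial_u f t v)"
proof -
  define \<alpha> where "\<alpha> = (\<lambda>h. t + c * h)"
  define \<psi> where "\<psi> = (\<lambda>h. v * exp (- eps2 * (c * h)\<^sup>2) + h * c * f t v)"
  have G: "G = (\<lambda>h. f (\<alpha> h) (\<psi> h))"
    by (simp add: G_def rbf_k2_def rbf_k1_def \<alpha>_def \<psi>_def)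
  have \<alpha>': "deriv \<alpha> = (\<lambda>_. c)"
    unfolding \<alpha>_def by (intro ext DERIV_imp_deriv) (auto intro!: derivative_eq_intros)
  have at_0: "\<alpha> 0 = t" "\<psi> 0 = v"
    by (simp_all add: \<alpha>_def \<psi>_def)
  have \<alpha>: "smooth_near j 0 \<alpha>" for j
    unfolding \<alpha>_def
    by (intro smooth_near_add smooth_near_mult smooth_near_const smooth_near_ident)
  have \<psi>: "smooth_near j 0 \<psi>" for j
    unfolding \<psi>_def by (rule smooth_near_rbf_stage)
  have in_D: "(\<alpha> 0, \<psi> 0) \<in> D"
    using assms(2) at_0 by simp
  note \<psi>' = rbf_stage_derivs[of v eps2 c "f t v", folded \<psi>_def]
  have "(G has_real_derivative partial_t f t v * deriv \<alpha> 0 + partial_u f t v * deriv \<psi> 0) (at 0)"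
    using eventually_nhds_x_imp_x[OF eventually_deriv_compose[of D \<alpha> 0 \<psi> f 0,
        OF assms(1) in_D Ck_on_le[OF Ck] \<alpha> \<psi>]]
    by (simp add: G at_0)
  then show "deriv G 0 = c * (partial_t f t v + partial_u f t v * f t v)"
    by (auto dest: DERIV_imp_deriv simp: \<alpha>' \<psi>' algebra_simps)
  show "deriv (deriv G) 0 = c\<^sup>2 * (second_directional_deriv f t v 1 (f t v) -
           2 * eps2 * v * partial_u f t v)"
    using second_deriv_compose[of D \<alpha> 0 \<psi> f, OF assms(1) in_D Ck \<alpha> \<psi>]
      second_directional_deriv_scale[of f t v c 1 "f t v"]
    by (simp add: G at_0 \<alpha>' \<psi>' algebra_simps)
qed

section \<open>The local truncation error\<close>

text \<open>The order conditions in terms of Taylor coefficients. The expansion of \<open>u\<close> goes one order further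
than that of the second stage, since its remainder is divided by \<open>h\<close>. The first stage is constant
in \<open>h\<close>, so it contributes to the term of order \<open>0\<close> only.\<close>

lemma rbf_local_error_bigo:
  assumes "k > 0" and "smooth_near (Suc k) t u"
    and "smooth_near k 0 (\<lambda>h. rbf_k2 f a21 c2 eps2 h t (u t))"
    and cond: "\<And>m. m < k \<Longrightarrow> (deriv ^^ Suc m) u t / fact (Suc m) =
      (if m = 0 then b1 * f t (u t) else 0) +
      b2 * ((deriv ^^ m) (\<lambda>h. rbf_k2 f a21 c2 eps2 h t (u t)) 0 / fact m)"
  shows "rbf_local_error f u a21 b1 b2 c2 eps2 t \<in> O[at 0](\<lambda>h. h ^ k)"
proof -
  define G where "G = (\<lambda>h. rbf_k2 f a21 c2 eps2 h t (u t))"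
  define R where "R = (\<lambda>h. u (t + h) - (\<Sum>m<Suc k. (deriv ^^ m) u t / fact m * h ^ m))"
  define S where "S = (\<lambda>h. G h - (\<Sum>m<k. (deriv ^^ m) G 0 / fact m * h ^ m))"
  have "R \<in> O[at 0](\<lambda>h. h ^ Suc k)"
    unfolding R_def using smooth_near_taylor[OF assms(2)] .
  then have "(\<lambda>h. R h / h) \<in> O[at 0](\<lambda>h. h ^ Suc k / h)"
    by (intro landau_o.big.divide_right) (auto simp: eventually_at_filter)
  also have "(\<lambda>h. h ^ Suc k / h) \<in> O[at 0](\<lambda>h::real. h ^ k)"
    by (intro bigoI[where c = 1]) (auto simp: eventually_at_filter)
  finally have "(\<lambda>h. R h / h) \<in> O[at 0](\<lambda>h. h ^ k)" .
  moreover have "S \<in> O[at 0](\<lambda>h. h ^ k)"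
    using smooth_near_taylor[OF assms(3)] by (simp add: S_def G_def)
  ultimately have "(\<lambda>h. R h / h - b2 * S h) \<in> O[at 0](\<lambda>h. h ^ k)"
    by (intro sum_in_bigo) auto
  moreover have "R h / h - b2 * S h = rbf_local_error f u a21 b1 b2 c2 eps2 t h" if "h \<noteq> 0" for h
  proof -
    have "(\<Sum>m<Suc k. (deriv ^^ m) u t / fact m * h ^ m) =
        u t + h * (\<Sum>m<k. (deriv ^^ Suc m) u t / fact (Suc m) * h ^ m)"
      by (subst sum.lessThan_Suc_shift) (simp add: sum_distrib_left mult_ac del: fact_Suc funpow.simps)
    also have "(\<Sum>m<k. (deriv ^^ Suc m) u t / fact (Suc m) * h ^ m) =
        (\<Sum>m<k. (if m = 0 then b1 * f t (u t) else 0) +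
          b2 * ((deriv ^^ m) G 0 / fact m * h ^ m))"
      by (intro sum.cong) (auto simp: cond G_def algebra_simps simp del: fact_Suc funpow.simps)
    also have "\<dots> = (\<Sum>m<k. if m = 0 then b1 * f t (u t) else 0) +
          b2 * (\<Sum>m<k. (deriv ^^ m) G 0 / fact m * h ^ m)"
      by (simp only: sum.distrib sum_distrib_left)
    also have "(\<Sum>m<k. if m = 0 then b1 * f t (u t) else 0) = b1 * f t (u t)"
      using \<open>k > 0\<close> by simp
    finally show ?thesis
      using that by (simp add: R_def S_def rbf_local_error_def rbf_k1_def G_def field_simps)
  qed
  ultimately show ?thesis
    by (subst (asm) landau_o.big.in_cong) (auto simp: eventually_at_filter)
qed

theorem mainTheorem1:
  fixes f :: "real \<Rightarrow> real \<Rightarrow> real" and u :: "real \<Rightarrow> real"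
    and D :: "(real \<times> real) set"
    and t a21 b1 b2 c2 eps2 :: real
  assumes "open D" and "(t, u t) \<in> D"
    and "\<forall>\<^sub>F s in nhds t. (u has_real_derivative f s (u s)) (at s)"
  shows "(Ck_on 2 D f \<and> b1 + b2 = 1 \<and> a21 = c2 \<and> b2 * c2 = 1 / 2 \<longrightarrow>
        rbf_local_error f u a21 b1 b2 c2 eps2 t \<in> O[at 0](\<lambda>h. h ^ 2)) \<and>
    (b1 + b2 = 1 \<and> a21 = c2 \<and> b2 * c2 = 1 / 2 \<and> b2 * c2\<^sup>2 = 1 / 3 \<longleftrightarrow>
        a21 = 2 / 3 \<and> c2 = 2 / 3 \<and> b1 = 1 / 4 \<and> b2 = 3 / 4) \<and>
    (Ck_on 3 D f \<and> b1 + b2 = 1 \<and> a21 = c2 \<and> b2 * c2 = 1 / 2 \<and> b2 * c2\<^sup>2 = 1 / 3 \<and>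
      u t \<noteq> 0 \<and>
      eps2 = - (partial_t f t (u t) + partial_u f t (u t) * f t (u t)) / (2 * u t) \<longrightarrow>
        deriv u field_differentiable (at t) \<and>
        eps2 = - deriv (deriv u) t / (2 * u t) \<and>
        rbf_local_error f u a21 b1 b2 c2 eps2 t \<in> O[at 0](\<lambda>h. h ^ 3))"
proof -
  let ?G = "\<lambda>h. rbf_k2 f c2 c2 eps2 h t (u t)"
  have G0: "?G 0 = f t (u t)"
    by (simp add: rbf_k2_def)
  have smooth: "smooth_near (Suc k) t u" "smooth_near k 0 ?G" if "Ck_on k D f" for k
    using smooth_near_ode_solution[of D t u k f, OF assms(1,2) that assms(3)]
      smooth_near_rbf_k2[OF assms(1,2) that] by (simp_all del: smooth_near.simps)
  note u_derivs = ode_solution_derivs[of D t u f, OF assms(1,2) _ assms(3)]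
  note G_derivs = rbf_k2_derivs[of D t "u t" f c2 eps2, OF assms(1,2)]
  have order1: "f t (u t) = b1 * f t (u t) + b2 * ?G 0" if "b1 + b2 = 1"
    using that G0 by (metis distrib_right mult_1)
  have order2: "deriv (deriv u) t / 2 = b2 * deriv ?G 0"
    if "Ck_on 2 D f" "b2 * c2 = 1 / 2"
    using that(2) by (simp add: u_derivs(2)[OF that(1)] G_derivs(1)[OF that(1)] flip: mult.assoc)
  have part1: "rbf_local_error f u a21 b1 b2 c2 eps2 t \<in> O[at 0](\<lambda>h. h ^ 2)"
    if "Ck_on 2 D f" "b1 + b2 = 1" "a21 = c2" "b2 * c2 = 1 / 2"
    unfolding that(3)
  proof (rule rbf_local_error_bigo[OF _ smooth[OF that(1)]])
    fix m :: nat assume "m < 2"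
    then consider "m = 0" | "m = 1"
      by linarith
    then show "(deriv ^^ Suc m) u t / fact (Suc m) =
        (if m = 0 then b1 * f t (u t) else 0) + b2 * ((deriv ^^ m) ?G 0 / fact m)"
      using order1[OF that(2)] order2[OF that(1,4)] u_derivs(1)[OF that(1)]
      by cases simp_all
  qed simp
  have coeffs: "b1 + b2 = 1 \<and> a21 = c2 \<and> b2 * c2 = 1 / 2 \<and> b2 * c2\<^sup>2 = 1 / 3 \<longleftrightarrow>
      a21 = 2 / 3 \<and> c2 = 2 / 3 \<and> b1 = 1 / 4 \<and> b2 = 3 / 4" (is "?L \<longleftrightarrow> ?R")
  proof
    assume L: ?L
    then have "b2 * c2 = 1 / 2" "(b2 * c2) * c2 = 1 / 3"
      by (simp_all add: power2_eq_square mult.assoc)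
    then have "c2 = 2 / 3"
      by (simp only:)
    with L show ?R
      by auto
  next
    assume ?R
    then show ?L
      by (elim conjE, hypsubst, simp add: power2_eq_square)
  qed
  have part2: "deriv u field_differentiable (at t) \<and>
      eps2 = - deriv (deriv u) t / (2 * u t) \<and>
      rbf_local_error f u a21 b1 b2 c2 eps2 t \<in> O[at 0](\<lambda>h. h ^ 3)"
    if Ck3: "Ck_on 3 D f" and b: "b1 + b2 = 1" "a21 = c2" "b2 * c2 = 1 / 2" "b2 * c2\<^sup>2 = 1 / 3"
      and "u t \<noteq> 0"
      and eps2: "eps2 = - (partial_t f t (u t) + partial_u f t (u t) * f t (u t)) / (2 * u t)"
  proof (intro conjI)
    have Ck2: "Ck_on 2 D f"
      using Ck3 by (rule Ck_on_le) simp
    show "deriv u field_differentiable (at t)"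
      using smooth(1)[OF Ck2] by (auto simp: numeral_2_eq_2 dest: eventually_nhds_x_imp_x)
    show "eps2 = - deriv (deriv u) t / (2 * u t)"
      by (simp add: eps2 u_derivs(2)[OF Ck2])
    \<comment> \<open>The stage value has the acceleration of the solution, up to the factor \<open>c2\<^sup>2\<close>.\<close>
    then have shape: "- 2 * eps2 * u t = deriv (deriv u) t"
      using \<open>u t \<noteq> 0\<close> by simp
    have "deriv (deriv ?G) 0 = c2\<^sup>2 * (second_directional_deriv f t (u t) 1 (f t (u t)) +
        (- 2 * eps2 * u t) * partial_u f t (u t))"
      by (simp add: G_derivs(2)[OF Ck2])
    also have "\<dots> = c2\<^sup>2 * deriv (deriv (deriv u)) t"
      unfolding shape u_derivs(3)[OF Ck2] by (simp add: mult.commute)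
    finally have "b2 * deriv (deriv ?G) 0 = (b2 * c2\<^sup>2) * deriv (deriv (deriv u)) t"
      by simp
    then have order3: "deriv (deriv (deriv u)) t / 6 = b2 * (deriv (deriv ?G) 0 / 2)"
      using b(4) by simp
    show "rbf_local_error f u a21 b1 b2 c2 eps2 t \<in> O[at 0](\<lambda>h. h ^ 3)"
      unfolding b(2)
    proof (rule rbf_local_error_bigo[OF _ smooth[OF Ck3]])
      fix m :: nat assume "m < 3"
      then consider "m = 0" | "m = 1" | "m = 2"
        by linarith
      then show "(deriv ^^ Suc m) u t / fact (Suc m) =
          (if m = 0 then b1 * f t (u t) else 0) + b2 * ((deriv ^^ m) ?G 0 / fact m)"
        using order1[OF b(1)] order2[OF Ck2 b(3)] order3 u_derivs(1)[OF Ck2]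
        by cases (simp_all add: numeral_2_eq_2)
    qed simp
  qed
  show ?thesis
    using part1 coeffs part2 by blast
qed

end
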